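(* Let $(C,\Delta,\varepsilon,P)$ be a Rota-Baxter coalgebra of weight $\lambda\in\mathbb{K}$ such that $\Delta P=(P\otimes P)\Delta$. Then for any two Rota-Baxter subcoalgebras $X$ and $Y$ of $C$, their wedge product $X\wedge Y$ is again a Rota-Baxter subcoalgebra of $C$.
   Context: $\mathbb{K}$ is a fixed ground field of characteristic 0; all vector spaces, coalgebras and tensor products are over $\mathbb{K}$. A Rota-Baxter coalgebra of weight $\lambda\in\mathbb{K}$ is a (coassociative, counital) coalgebra $(C,\Delta,\varepsilon)$ equipped with a linear operator $P:C\to C$ such that $(P\otimes P)\Delta=(\mathrm{id}\otimes P)\Delta P+(P\otimes\mathrm{id})\Delta P+\lambda\Delta P$. A Rota-Baxter subcoalgebra of $C$ is a subcoalgebra $D$ of $C$ with $P(D)\subset D$. For subcoalgebras $X,Y$ of $C$, the wedge product is $X\wedge Y=\Delta^{-1}(X\otimes C+C\otimes Y)$. *)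

theory Defs
  imports Complex_Main "HOL-Library.Poly_Mapping"
begin

text \<open>
  A vector space over the field \<open>'k\<close> is an abelian group type with a scalar multiplication
  satisfying \<^locale>\<open>vector_space\<close>. The tensor products \<open>C \<otimes> C\<close> and
  \<open>C \<otimes> C \<otimes> C\<close> are constructed as the vector space freely generated by all pairs (triples)
  modulo the subspace spanned by the multilinearity relations. As HOL has no dependent types,
  these quotients are sets of cosets with explicitly given operations.
\<close>


section \<open>Free vector spaces and their quotients\<close>

definition fscale :: "'k::field \<Rightarrow> ('i \<Rightarrow>\<^sub>0 'k) \<Rightarrow> ('i \<Rightarrow>\<^sub>0 'k)"
  where "fscale a = Poly_Mapping.map ((*) a)"

lemma lookup_fscale [simp]:
  "Poly_Mapping.lookup (fscale a u) i = a * Poly_Mapping.lookup u i"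
  unfolding fscale_def by (simp add: map.rep_eq when_def)

global_interpretation free: vector_space "fscale :: 'k::field \<Rightarrow> ('i \<Rightarrow>\<^sub>0 'k) \<Rightarrow> _"
  by unfold_locales (auto intro!: poly_mapping_eqI simp: lookup_add algebra_simps)

abbreviation gen :: "'i \<Rightarrow> ('i \<Rightarrow>\<^sub>0 'k::field)"
  where "gen i \<equiv> Poly_Mapping.single i 1"

text \<open>
  Below, \<open>N\<close> is the subspace that is factored out. The operations on cosets are defined by means
  of arbitrarily chosen representatives (see the lemmas for the independence of this choice).
\<close>

definition qclass :: "('i \<Rightarrow>\<^sub>0 'k::field) set \<Rightarrow> ('i \<Rightarrow>\<^sub>0 'k) \<Rightarrow> ('i \<Rightarrow>\<^sub>0 'k) set"
  where "qclass N u = {v. v - u \<in> N}"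

definition qrep :: "('i \<Rightarrow>\<^sub>0 'k::field) set \<Rightarrow> ('i \<Rightarrow>\<^sub>0 'k)"
  where "qrep s = (SOME u. u \<in> s)"

definition qadd ::
  "('i \<Rightarrow>\<^sub>0 'k::field) set \<Rightarrow> ('i \<Rightarrow>\<^sub>0 'k) set \<Rightarrow> ('i \<Rightarrow>\<^sub>0 'k) set \<Rightarrow> ('i \<Rightarrow>\<^sub>0 'k) set"
  where "qadd N s t = qclass N (qrep s + qrep t)"

definition qscale ::
  "('i \<Rightarrow>\<^sub>0 'k::field) set \<Rightarrow> 'k \<Rightarrow> ('i \<Rightarrow>\<^sub>0 'k) set \<Rightarrow> ('i \<Rightarrow>\<^sub>0 'k) set"
  where "qscale N a s = qclass N (fscale a (qrep s))"

text \<open>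
  Linear extension of a map given on generators: \<open>lin_ext\<close> has values in an ordinary vector space,
  \<open>qlin_ext\<close> in the quotient of a free vector space by \<open>N\<close>. Both are meant for maps on generators
  that respect the relations defining the source of the extension.
\<close>

definition lin_ext ::
  "('k::field \<Rightarrow> 'v \<Rightarrow> 'v) \<Rightarrow> ('i \<Rightarrow> 'v::ab_group_add) \<Rightarrow> ('i \<Rightarrow>\<^sub>0 'k) set \<Rightarrow> 'v"
  where "lin_ext scl F s =
    (\<Sum>i\<in>Poly_Mapping.keys (qrep s). scl (Poly_Mapping.lookup (qrep s) i) (F i))"

definition qlin_ext ::
  "('j \<Rightarrow>\<^sub>0 'k::field) set \<Rightarrow> ('i \<Rightarrow> ('j \<Rightarrow>\<^sub>0 'k) set) \<Rightarrow> ('i \<Rightarrow>\<^sub>0 'k) set \<Rightarrow> ('j \<Rightarrow>\<^sub>0 'k) set"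
  where "qlin_ext N F s = qclass N (lin_ext fscale (\<lambda>i. qrep (F i)) s)"

lemma qclass_eq_iff:
  assumes "free.subspace N"
  shows "qclass N u = qclass N v \<longleftrightarrow> u - v \<in> N"
proof
  assume eq: "qclass N u = qclass N v"
  have "u \<in> qclass N u"
    using assms by (simp add: qclass_def free.subspace_0)
  then show "u - v \<in> N"
    unfolding eq by (simp add: qclass_def)
next
  assume *: "u - v \<in> N"
  have "w - u \<in> N \<longleftrightarrow> w - v \<in> N" for w
    using free.subspace_add[OF assms _ *, of "w - u"] free.subspace_diff[OF assms _ *, of "w - v"]
    by auto
  then show "qclass N u = qclass N v"
    by (simp add: qclass_def)
qed

lemma qrep_qclass:
  assumes "free.subspace N"
  shows "qrep (qclass N u) - u \<in> N"
proof -
  have "u \<in> qclass N u"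
    using assms by (simp add: qclass_def free.subspace_0)
  then have "qrep (qclass N u) \<in> qclass N u"
    unfolding qrep_def by (rule someI)
  then show ?thesis
    by (simp add: qclass_def)
qed

lemma qadd_qclass:
  assumes "free.subspace N"
  shows "qadd N (qclass N u) (qclass N v) = qclass N (u + v)"
  unfolding qadd_def qclass_eq_iff[OF assms]
  using free.subspace_add[OF assms qrep_qclass[OF assms, of u] qrep_qclass[OF assms, of v]]
  by (simp add: algebra_simps)

lemma qscale_qclass:
  assumes "free.subspace N"
  shows "qscale N a (qclass N u) = qclass N (fscale a u)"
  unfolding qscale_def qclass_eq_iff[OF assms]
  using free.subspace_scale[OF assms qrep_qclass[OF assms, of u], of a]
  by (simp add: free.scale_right_diff_distrib)

lemma lin_sum_linear:
  assumes "vector_space scl"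
  shows "Vector_Spaces.linear fscale scl
    (\<lambda>u. \<Sum>i\<in>Poly_Mapping.keys u. scl (Poly_Mapping.lookup u i) (F i))"
    (is "Vector_Spaces.linear _ _ ?L")
proof -
  interpret V: vector_space scl by fact
  have L: "?L u = (\<Sum>i\<in>A. scl (Poly_Mapping.lookup u i) (F i))"
    if "finite A" "Poly_Mapping.keys u \<subseteq> A" for u A
    using that by (intro sum.mono_neutral_left) (auto simp: in_keys_iff)
  have add: "?L (u + v) = ?L u + ?L v" for u v
  proof -
    let ?A = "Poly_Mapping.keys u \<union> Poly_Mapping.keys v"
    have "?L (u + v) = (\<Sum>i\<in>?A. scl (Poly_Mapping.lookup (u + v) i) (F i))"
      by (rule L) (auto simp: in_keys_iff lookup_add)
    moreover have "?L u = (\<Sum>i\<in>?A. scl (Poly_Mapping.lookup u i) (F i))"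
      by (rule L) auto
    moreover have "?L v = (\<Sum>i\<in>?A. scl (Poly_Mapping.lookup v i) (F i))"
      by (rule L) auto
    ultimately show ?thesis
      by (simp add: lookup_add V.scale_left_distrib sum.distrib)
  qed
  have scale: "?L (fscale a u) = scl a (?L u)" for a u
  proof -
    have "?L (fscale a u) =
      (\<Sum>i\<in>Poly_Mapping.keys u. scl (Poly_Mapping.lookup (fscale a u) i) (F i))"
      by (rule L) (auto simp: in_keys_iff)
    then show ?thesis
      by (simp add: V.scale_sum_right)
  qed
  show ?thesis
    by unfold_locales (simp_all only: add scale)
qed

lemma lin_ext_qclass:
  assumes "vector_space scl"
    and "\<And>g. g \<in> G \<Longrightarrow> (\<Sum>i\<in>Poly_Mapping.keys g. scl (Poly_Mapping.lookup g i) (F i)) = 0"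
  shows "lin_ext scl F (qclass (free.span G) u) =
    (\<Sum>i\<in>Poly_Mapping.keys u. scl (Poly_Mapping.lookup u i) (F i))"
proof -
  let ?L = "\<lambda>u. \<Sum>i\<in>Poly_Mapping.keys u. scl (Poly_Mapping.lookup u i) (F i)"
  interpret L: Vector_Spaces.linear fscale scl ?L
    by (rule lin_sum_linear) fact
  have "?L w = 0" if "w \<in> free.span G" for w
    using that assms(2) by (rule L.eq_0_on_span[rotated])
  with qrep_qclass[OF free.subspace_span, of G u]
  have "?L (qrep (qclass (free.span G) u) - u) = 0"
    by blast
  then show ?thesis
    unfolding lin_ext_def L.diff by simp
qed

lemma qlin_ext_qclass:
  assumes "free.subspace N"
    and "\<And>g. g \<in> G \<Longrightarrow>
      (\<Sum>i\<in>Poly_Mapping.keys g. fscale (Poly_Mapping.lookup g i) (qrep (F i))) \<in> N"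
  shows "qlin_ext N F (qclass (free.span G) u) =
    qclass N (\<Sum>i\<in>Poly_Mapping.keys u. fscale (Poly_Mapping.lookup u i) (qrep (F i)))"
proof -
  let ?L = "\<lambda>u. \<Sum>i\<in>Poly_Mapping.keys u. fscale (Poly_Mapping.lookup u i) (qrep (F i))"
  interpret L: Vector_Spaces.linear fscale fscale ?L
    by (rule lin_sum_linear) unfold_locales
  have "free.subspace {w. ?L w \<in> N}"
    using L.subspace_vimage[OF assms(1)] by (simp add: vimage_def)
  then have "free.span G \<subseteq> {w. ?L w \<in> N}"
    using assms(2) by (intro free.span_minimal) auto
  with qrep_qclass[OF free.subspace_span, of G u]
  have "?L (qrep (qclass (free.span G) u) - u) \<in> N"
    by blast
  then show ?thesis
    unfolding qlin_ext_def lin_ext_def qclass_eq_iff[OF assms(1)] L.diff .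
qed


section \<open>Tensor products\<close>

definition tensor_null ::
  "('k::field \<Rightarrow> 'c \<Rightarrow> 'c) \<Rightarrow> ('c::ab_group_add \<times> 'c \<Rightarrow>\<^sub>0 'k) set"
  where "tensor_null scl = free.span
    ({gen (x + x', y) - gen (x, y) - gen (x', y) | x x' y. True} \<union>
     {gen (x, y + y') - gen (x, y) - gen (x, y') | x y y'. True} \<union>
     {gen (scl a x, y) - fscale a (gen (x, y)) | a x y. True} \<union>
     {gen (x, scl a y) - fscale a (gen (x, y)) | a x y. True})"

definition tensor3_null ::
  "('k::field \<Rightarrow> 'c \<Rightarrow> 'c) \<Rightarrow> ('c::ab_group_add \<times> 'c \<times> 'c \<Rightarrow>\<^sub>0 'k) set"
  where "tensor3_null scl = free.span
    ({gen (x + x', y, z) - gen (x, y, z) - gen (x', y, z) | x x' y z. True} \<union>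
     {gen (x, y + y', z) - gen (x, y, z) - gen (x, y', z) | x y y' z. True} \<union>
     {gen (x, y, z + z') - gen (x, y, z) - gen (x, y, z') | x y z z'. True} \<union>
     {gen (scl a x, y, z) - fscale a (gen (x, y, z)) | a x y z. True} \<union>
     {gen (x, scl a y, z) - fscale a (gen (x, y, z)) | a x y z. True} \<union>
     {gen (x, y, scl a z) - fscale a (gen (x, y, z)) | a x y z. True})"

definition tensor_space ::
  "('k::field \<Rightarrow> 'c \<Rightarrow> 'c) \<Rightarrow> ('c::ab_group_add \<times> 'c \<Rightarrow>\<^sub>0 'k) set set"
  where "tensor_space scl = range (qclass (tensor_null scl))"

definition tensor ::
  "('k::field \<Rightarrow> 'c \<Rightarrow> 'c) \<Rightarrow> 'c::ab_group_add \<Rightarrow> 'c \<Rightarrow> ('c \<times> 'c \<Rightarrow>\<^sub>0 'k) set"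
  where "tensor scl x y = qclass (tensor_null scl) (gen (x, y))"

definition tensor3 ::
  "('k::field \<Rightarrow> 'c \<Rightarrow> 'c) \<Rightarrow> 'c::ab_group_add \<Rightarrow> 'c \<Rightarrow> 'c \<Rightarrow> ('c \<times> 'c \<times> 'c \<Rightarrow>\<^sub>0 'k) set"
  where "tensor3 scl x y z = qclass (tensor3_null scl) (gen (x, y, z))"

abbreviation tensor_add ::
  "('k::field \<Rightarrow> 'c \<Rightarrow> 'c) \<Rightarrow> ('c::ab_group_add \<times> 'c \<Rightarrow>\<^sub>0 'k) set \<Rightarrow> ('c \<times> 'c \<Rightarrow>\<^sub>0 'k) set
    \<Rightarrow> ('c \<times> 'c \<Rightarrow>\<^sub>0 'k) set"
  where "tensor_add scl \<equiv> qadd (tensor_null scl)"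

abbreviation tensor_scale ::
  "('k::field \<Rightarrow> 'c \<Rightarrow> 'c) \<Rightarrow> 'k \<Rightarrow> ('c::ab_group_add \<times> 'c \<Rightarrow>\<^sub>0 'k) set
    \<Rightarrow> ('c \<times> 'c \<Rightarrow>\<^sub>0 'k) set"
  where "tensor_scale scl \<equiv> qscale (tensor_null scl)"

text \<open>The subspace \<open>X \<otimes> Y\<close> of \<open>C \<otimes> C\<close>, i.e. the linear span of all \<open>x \<otimes> y\<close>.\<close>

definition tensor_sub ::
  "('k::field \<Rightarrow> 'c \<Rightarrow> 'c) \<Rightarrow> 'c::ab_group_add set \<Rightarrow> 'c set \<Rightarrow> ('c \<times> 'c \<Rightarrow>\<^sub>0 'k) set set"
  where "tensor_sub scl X Y =
    qclass (tensor_null scl) ` free.span {gen (x, y) | x y. x \<in> X \<and> y \<in> Y}"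

text \<open>The map \<open>f \<otimes> g\<close> for linear endomorphisms \<open>f\<close> and \<open>g\<close> of \<open>C\<close>.\<close>

definition tensor_map ::
  "('k::field \<Rightarrow> 'c \<Rightarrow> 'c) \<Rightarrow> ('c \<Rightarrow> 'c) \<Rightarrow> ('c \<Rightarrow> 'c) \<Rightarrow> ('c::ab_group_add \<times> 'c \<Rightarrow>\<^sub>0 'k) set
    \<Rightarrow> ('c \<times> 'c \<Rightarrow>\<^sub>0 'k) set"
  where "tensor_map scl f g = qlin_ext (tensor_null scl) (\<lambda>(x, y). tensor scl (f x) (g y))"

text \<open>
  The maps \<open>\<Delta> \<otimes> id\<close> and \<open>id \<otimes> \<Delta>\<close> from \<open>C \<otimes> C\<close> to \<open>C \<otimes> C \<otimes> C\<close>, the latter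
  being identified with both iterated tensor products. The inner linear extensions are the maps
  \<open>s \<mapsto> s \<otimes> y\<close> and \<open>s \<mapsto> x \<otimes> s\<close> from \<open>C \<otimes> C\<close> to \<open>C \<otimes> C \<otimes> C\<close>.
\<close>

definition comult_left ::
  "('k::field \<Rightarrow> 'c \<Rightarrow> 'c) \<Rightarrow> ('c \<Rightarrow> ('c \<times> 'c \<Rightarrow>\<^sub>0 'k) set)
    \<Rightarrow> ('c::ab_group_add \<times> 'c \<Rightarrow>\<^sub>0 'k) set \<Rightarrow> ('c \<times> 'c \<times> 'c \<Rightarrow>\<^sub>0 'k) set"
  where "comult_left scl \<Delta> = qlin_ext (tensor3_null scl)
    (\<lambda>(x, y). qlin_ext (tensor3_null scl) (\<lambda>(x\<^sub>1, x\<^sub>2). tensor3 scl x\<^sub>1 x\<^sub>2 y) (\<Delta> x))"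

definition comult_right ::
  "('k::field \<Rightarrow> 'c \<Rightarrow> 'c) \<Rightarrow> ('c \<Rightarrow> ('c \<times> 'c \<Rightarrow>\<^sub>0 'k) set)
    \<Rightarrow> ('c::ab_group_add \<times> 'c \<Rightarrow>\<^sub>0 'k) set \<Rightarrow> ('c \<times> 'c \<times> 'c \<Rightarrow>\<^sub>0 'k) set"
  where "comult_right scl \<Delta> = qlin_ext (tensor3_null scl)
    (\<lambda>(x, y). qlin_ext (tensor3_null scl) (\<lambda>(y\<^sub>1, y\<^sub>2). tensor3 scl x y\<^sub>1 y\<^sub>2) (\<Delta> y))"


section \<open>Rota-Baxter coalgebras\<close>

text \<open>
  The counit axioms use the identifications of \<open>K \<otimes> C\<close> and \<open>C \<otimes> K\<close> with \<open>C\<close>.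
\<close>

locale coalgebra = vector_space scl
  for scl :: "'k::field_char_0 \<Rightarrow> 'c::ab_group_add \<Rightarrow> 'c" +
  fixes \<Delta> :: "'c \<Rightarrow> ('c \<times> 'c \<Rightarrow>\<^sub>0 'k) set"
    and \<epsilon> :: "'c \<Rightarrow> 'k"
  assumes comult_in: "\<Delta> x \<in> tensor_space scl"
    and comult_add: "\<Delta> (x + y) = tensor_add scl (\<Delta> x) (\<Delta> y)"
    and comult_scale: "\<Delta> (scl a x) = tensor_scale scl a (\<Delta> x)"
    and counit_linear: "Vector_Spaces.linear scl (*) \<epsilon>"
    and coassoc: "comult_left scl \<Delta> (\<Delta> x) = comult_right scl \<Delta> (\<Delta> x)"
    and counit_left: "lin_ext scl (\<lambda>(x\<^sub>1, x\<^sub>2). scl (\<epsilon> x\<^sub>1) x\<^sub>2) (\<Delta> x) = x"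
    and counit_right: "lin_ext scl (\<lambda>(x\<^sub>1, x\<^sub>2). scl (\<epsilon> x\<^sub>2) x\<^sub>1) (\<Delta> x) = x"
begin

definition subcoalgebra :: "'c set \<Rightarrow> bool"
  where "subcoalgebra D \<longleftrightarrow> subspace D \<and> \<Delta> ` D \<subseteq> tensor_sub scl D D"

definition wedge :: "'c set \<Rightarrow> 'c set \<Rightarrow> 'c set"
  where "wedge X Y = \<Delta> -`
    {tensor_add scl s t | s t. s \<in> tensor_sub scl X UNIV \<and> t \<in> tensor_sub scl UNIV Y}"

end

locale rota_baxter_coalgebra = coalgebra scl \<Delta> \<epsilon>
  for scl :: "'k::field_char_0 \<Rightarrow> 'c::ab_group_add \<Rightarrow> 'c"
    and \<Delta> :: "'c \<Rightarrow> ('c \<times> 'c \<Rightarrow>\<^sub>0 'k) set"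
    and \<epsilon> :: "'c \<Rightarrow> 'k" +
  fixes P :: "'c \<Rightarrow> 'c"
    and weight :: 'k
  assumes operator_linear: "Vector_Spaces.linear scl scl P"
    and rota_baxter: "tensor_map scl P P (\<Delta> x) =
      tensor_add scl
        (tensor_add scl (tensor_map scl id P (\<Delta> (P x))) (tensor_map scl P id (\<Delta> (P x))))
        (tensor_scale scl weight (\<Delta> (P x)))"
begin

definition rota_baxter_subcoalgebra :: "'c set \<Rightarrow> bool"
  where "rota_baxter_subcoalgebra D \<longleftrightarrow> subcoalgebra D \<and> P ` D \<subseteq> D"

end

end

theory Submission
  imports Defs
begin

text \<open>
  For \<open>w \<in> X \<and> Y\<close> write \<open>\<Delta> w = \<Sum>i. a\<^sub>i \<otimes> b\<^sub>i\<close> with as few summands as possible, so that the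
  \<open>a\<^sub>i\<close> and the \<open>b\<^sub>i\<close> are linearly independent. A functional dual to \<open>a\<^sub>i\<close> recovers
  \<open>\<Delta> b\<^sub>i\<close> from \<open>(id \<otimes> \<Delta>) \<Delta> w = (\<Delta> \<otimes> id) \<Delta> w \<in> X \<otimes> X \<otimes> C + C \<otimes> C \<otimes> Y\<close>, whence
  \<open>b\<^sub>i \<in> X \<and> Y\<close>; symmetrically \<open>a\<^sub>i \<in> X \<and> Y\<close>. The invariance under \<open>P\<close> is immediate from
  \<open>\<Delta> P = (P \<otimes> P) \<Delta>\<close>.
\<close>

section \<open>Linear extension to free vector spaces\<close>

text \<open>The sum inside \<open>lin_ext\<close>, taken over an element of the free space.
  Computations below are made on representatives modulo a subspace; cosets occur only where the
  given definitions are met.\<close>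

definition lsum :: "('i \<Rightarrow> ('j \<Rightarrow>\<^sub>0 'k::field)) \<Rightarrow> ('i \<Rightarrow>\<^sub>0 'k) \<Rightarrow> ('j \<Rightarrow>\<^sub>0 'k)"
  where "lsum f u = (\<Sum>i\<in>Poly_Mapping.keys u. fscale (Poly_Mapping.lookup u i) (f i))"

lemma linear_lsum: "Vector_Spaces.linear fscale fscale (lsum f)"
  using lin_sum_linear[OF free.vector_space_axioms] by (simp add: lsum_def[abs_def])

interpretation lsum: Vector_Spaces.linear fscale fscale "lsum f"
  for f :: "'i \<Rightarrow> ('j \<Rightarrow>\<^sub>0 'k::field)"
  by (rule linear_lsum)

lemma lsum_gen [simp]: "lsum f (gen i) = f i"
  by (simp add: lsum_def)

lemma lsum_gen_id [simp]: "lsum gen u = u"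
proof (rule poly_mapping_eqI)
  fix k
  show "Poly_Mapping.lookup (lsum gen u) k = Poly_Mapping.lookup u k"
    by (cases "k \<in> Poly_Mapping.keys u")
      (auto simp: lsum_def lookup_sum lookup_single when_def in_keys_iff if_distrib cong: if_cong)
qed

lemma lsum_lsum: "lsum g (lsum f u) = lsum (\<lambda>i. lsum g (f i)) u"
  by (simp add: lsum_def[of f] lsum_def[of "\<lambda>i. lsum g (f i)"] lsum.sum lsum.scale)

lemma lsum_fun_diff: "lsum (\<lambda>i. f i - g i) u = lsum f u - lsum g u"
  by (simp add: lsum_def free.scale_right_diff_distrib sum_subtractf)

lemma lsum_fun_scale: "lsum (\<lambda>i. fscale a (f i)) u = fscale a (lsum f u)"
  by (simp add: lsum_def free.scale_sum_right mult.commute)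

lemma lsum_in_subspace:
  assumes "free.subspace N" "\<And>i. f i \<in> N"
  shows "lsum f u \<in> N"
  unfolding lsum_def using assms by (intro free.subspace_sum free.subspace_scale)

lemma lsum_span:
  assumes "free.subspace T" "\<And>g. g \<in> G \<Longrightarrow> lsum f g \<in> T" "u \<in> free.span G"
  shows "lsum f u \<in> T"
proof -
  have "free.span G \<subseteq> lsum f -` T"
    using assms(1,2) by (intro free.span_minimal lsum.subspace_vimage) auto
  with assms(3) show ?thesis
    by blast
qed

lemma qclass_qrep:
  assumes "free.subspace N" "s \<in> range (qclass N)"
  shows "qclass N (qrep s) = s"
  using assms qclass_eq_iff qrep_qclass by (metis imageE)

text \<open>\<open>qlin_ext\<close> selects its own representatives of the cosets
  \<open>F i\<close>. Replacing them by \<open>f i\<close> changes the resulting sum by an element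
  of \<open>N\<close> only, so any convenient \<open>f\<close> may be used.\<close>

lemma qlin_ext_qclass_lsum:
  assumes N: "free.subspace N"
    and F: "\<And>i. F i = qclass N (f i)"
    and G: "\<And>g. g \<in> G \<Longrightarrow> lsum f g \<in> N"
  shows "qlin_ext N F (qclass (free.span G) u) = qclass N (lsum f u)"
proof -
  have diff: "lsum (\<lambda>i. qrep (F i)) v - lsum f v \<in> N" for v
    unfolding lsum_fun_diff[symmetric] F by (intro lsum_in_subspace N qrep_qclass)
  have "lsum (\<lambda>i. qrep (F i)) g \<in> N" if "g \<in> G" for g
    using free.subspace_add[OF N diff[of g] G[OF that]] by simp
  then have "qlin_ext N F (qclass (free.span G) u) = qclass N (lsum (\<lambda>i. qrep (F i)) u)"
    using qlin_ext_qclass[OF N, of G F u] by (simp add: lsum_def)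
  also have "\<dots> = qclass N (lsum f u)"
    using diff by (simp add: qclass_eq_iff[OF N])
  finally show ?thesis .
qed


section \<open>Tensors modulo the multilinearity relations\<close>

text \<open>Bilinearity is required only modulo \<open>N\<close>, because maps built from
  arbitrarily chosen representatives need not be bilinear on the nose.\<close>

definition bilinear_mod ::
  "('k::field \<Rightarrow> 'c \<Rightarrow> 'c) \<Rightarrow> ('j \<Rightarrow>\<^sub>0 'k) set \<Rightarrow> ('c::ab_group_add \<times> 'c \<Rightarrow> ('j \<Rightarrow>\<^sub>0 'k)) \<Rightarrow> bool"
  where "bilinear_mod scl N f \<longleftrightarrow>
    (\<forall>x x' y. f (x + x', y) - f (x, y) - f (x', y) \<in> N) \<and>
    (\<forall>x y y'. f (x, y + y') - f (x, y) - f (x, y') \<in> N) \<and>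
    (\<forall>a x y. f (scl a x, y) - fscale a (f (x, y)) \<in> N) \<and>
    (\<forall>a x y. f (x, scl a y) - fscale a (f (x, y)) \<in> N)"

lemma bilinear_mod_mono: "bilinear_mod scl N f \<Longrightarrow> N \<subseteq> T \<Longrightarrow> bilinear_mod scl T f"
  unfolding bilinear_mod_def by blast

lemma subspace_tensor_null: "free.subspace (tensor_null scl)"
  by (simp add: tensor_null_def)

lemma subspace_tensor3_null: "free.subspace (tensor3_null scl)"
  by (simp add: tensor3_null_def)

lemma bilinear_mod_gen: "bilinear_mod scl (tensor_null scl) gen"
  unfolding bilinear_mod_def tensor_null_def by (intro conjI allI free.span_base; fast)

lemma bilinear_mod_swap:
  "bilinear_mod scl N f \<Longrightarrow> bilinear_mod scl N (\<lambda>(x, y). f (y, x))"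
  unfolding bilinear_mod_def by simp

lemma bilinear_mod_fscale:
  assumes N: "free.subspace N" and f: "bilinear_mod scl N f"
  shows "bilinear_mod scl N (\<lambda>p. fscale c (f p))"
  using f free.subspace_scale[OF N, of _ c] unfolding bilinear_mod_def
    free.scale_right_diff_distrib[symmetric] free.scale_left_commute[of _ c] by blast

lemma bilinear_mod_lsum:
  assumes "bilinear_mod scl N f" "\<And>u. u \<in> N \<Longrightarrow> lsum h u \<in> T"
  shows "bilinear_mod scl T (\<lambda>p. lsum h (f p))"
  using assms unfolding bilinear_mod_def lsum.diff[symmetric] lsum.scale[symmetric] by blast

text \<open>The preimage in the free space of a subspace of the tensor product. With a set of pairs
  instead of two factors, X \<otimes> C + C \<otimes> Y comes from the single set
  \<open>X \<times> UNIV \<union> UNIV \<times> Y\<close>.\<close>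

definition tspan ::
  "('k::field \<Rightarrow> 'c \<Rightarrow> 'c) \<Rightarrow> ('c::ab_group_add \<times> 'c) set \<Rightarrow> ('c \<times> 'c \<Rightarrow>\<^sub>0 'k) set"
  where "tspan scl A = free.span (gen ` A \<union> tensor_null scl)"

lemma subspace_tspan: "free.subspace (tspan scl A)"
  by (simp add: tspan_def)

lemma gen_in_tspan: "p \<in> A \<Longrightarrow> gen p \<in> tspan scl A"
  by (simp add: tspan_def free.span_base)

lemma tensor_null_le_tspan: "tensor_null scl \<subseteq> tspan scl A"
  by (auto simp: tspan_def free.span_base)

lemma tspan_cong:
  assumes "u - v \<in> tensor_null scl"
  shows "u \<in> tspan scl A \<longleftrightarrow> v \<in> tspan scl A"
proof -
  have "u - v \<in> tspan scl A"
    using assms tensor_null_le_tspan by blast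
  then show ?thesis
    using free.subspace_add[OF subspace_tspan, of "u - v" scl A v]
      free.subspace_diff[OF subspace_tspan, of u scl A "u - v"] by auto
qed

text \<open>Universal property of the tensor product: the four clauses of
  \<open>bilinear_mod\<close> match the four families of relations.\<close>

lemma lsum_tensor_null:
  assumes T: "free.subspace T" and f: "bilinear_mod scl T f" and u: "u \<in> tensor_null scl"
  shows "lsum f u \<in> T"
  using f by (intro lsum_span[OF T _ u[unfolded tensor_null_def]])
    (auto simp: bilinear_mod_def lsum.diff lsum.scale)

lemma lsum_tspan:
  assumes T: "free.subspace T" and f: "bilinear_mod scl T f"
    and A: "\<And>p. p \<in> A \<Longrightarrow> f p \<in> T" and u: "u \<in> tspan scl A"
  shows "lsum f u \<in> T"
  using A lsum_tensor_null[OF T f] by (intro lsum_span[OF T _ u[unfolded tspan_def]]) auto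

lemma qlin_ext_tensor:
  assumes N: "free.subspace N" and "\<And>p. F p = qclass N (f p)" and f: "bilinear_mod scl N f"
  shows "qlin_ext N F (qclass (tensor_null scl) u) = qclass N (lsum f u)"
proof -
  have "lsum f g \<in> N" if "g \<in> tensor_null scl" for g
    using lsum_tensor_null[OF N f that] .
  \<comment> \<open>\<open>tensor_null\<close> acts as its own generating set, which avoids going
    through the relations again.\<close>
  then have "qlin_ext N F (qclass (free.span (tensor_null scl)) u) = qclass N (lsum f u)"
    by (intro qlin_ext_qclass_lsum assms)
  then show ?thesis
    by (simp add: tensor_null_def free.span_span)
qed

text \<open>The span of a union is the sum of the spans, so elements of \<open>tspan\<close> are
  those that differ from a combination of generators by an element of
  \<open>tensor_null\<close>.\<close>

lemma qclass_in_tensor_sub_iff: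
  "qclass (tensor_null scl) u \<in> tensor_sub scl X Y \<longleftrightarrow> u \<in> tspan scl (X \<times> Y)"
proof -
  have eq: "{gen (x, y) | x y. x \<in> X \<and> y \<in> Y} = gen ` (X \<times> Y)"
    by auto
  have "tspan scl (X \<times> Y) = {v + n | v n. v \<in> free.span (gen ` (X \<times> Y)) \<and> n \<in> tensor_null scl}"
    unfolding tspan_def free.span_Un by (simp add: tensor_null_def free.span_span)
  also have "u \<in> \<dots> \<longleftrightarrow> (\<exists>v\<in>free.span (gen ` (X \<times> Y)). u - v \<in> tensor_null scl)"
    by (force simp: algebra_simps)
  finally show ?thesis
    unfolding tensor_sub_def eq image_iff qclass_eq_iff[OF subspace_tensor_null] by blast
qed

section \<open>Minimal representations of tensors and separating functionals\<close>

context vector_space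
begin

text \<open>Induction over linear combinations: for a new term \<open>scale c x\<close> with
  \<open>x = a j\<close>, the scalar crosses the tensor sign and \<open>scale c y\<close> is added
  to \<open>b j\<close>.\<close>

lemma bilinear_mod_expand_left:
  assumes T: "free.subspace T" and f: "bilinear_mod scale T f"
    and J: "finite J" and v: "v \<in> span (a ` J)"
  shows "\<exists>b. f (v, y) - (\<Sum>j\<in>J. f (a j, b j)) \<in> T"
  using v
proof (induction rule: span_induct_alt)
  case base
  have zero: "f (x, 0) \<in> T" "f (0, x) \<in> T" for x
    using f unfolding bilinear_mod_def by (metis scale_zero_left free.scale_zero_left diff_zero)+
  then have "f (0, y) - (\<Sum>j\<in>J. f (a j, (\<lambda>_. 0) j)) \<in> T"
    by (intro free.subspace_diff[OF T] free.subspace_sum[OF T])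
  then show ?case
    by (rule exI[of _ "\<lambda>_. 0"])
next
  case (step c x v)
  then obtain b j where b: "f (v, y) - (\<Sum>j\<in>J. f (a j, b j)) \<in> T" and j: "j \<in> J" "x = a j"
    by blast
  let ?b = "b(j := b j + scale c y)"
  have "f (scale c x + v, y) - f (scale c x, y) - f (v, y) \<in> T"
    "f (scale c x, y) - fscale c (f (x, y)) \<in> T"
    "f (x, scale c y) - fscale c (f (x, y)) \<in> T"
    "f (x, b j + scale c y) - f (x, b j) - f (x, scale c y) \<in> T"
    using f unfolding bilinear_mod_def by blast+
  \<comment> \<open>Left additivity splits off \<open>scale c x\<close>, homogeneity carries the
    scalar to the right factor, and right additivity merges the result with
    \<open>b j\<close>.\<close>
  from free.subspace_diff[OF T free.subspace_diff[OF T
      free.subspace_add[OF T free.subspace_add[OF T this(1,2)] b] this(3)] this(4)]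
  have "f (scale c x + v, y) - ((\<Sum>j\<in>J. f (a j, b j)) - f (x, b j) + f (x, b j + scale c y)) \<in> T"
    by (simp add: algebra_simps)
  also have "(\<Sum>j\<in>J. f (a j, b j)) - f (x, b j) + f (x, b j + scale c y) =
    (\<Sum>j\<in>J. f (a j, ?b j))"
    using J j by (simp add: sum.remove[of J j])
  finally show ?case
    by (rule exI[of _ ?b])
qed

text \<open>The term at \<open>k\<close> is spread over the remaining ones and absorbed into their
  right factors. A general \<open>f\<close> makes the lemma serve dependent right factors too,
  through the swapped generator map.\<close>

lemma bilinear_mod_shorten:
  assumes T: "free.subspace T" and f: "bilinear_mod scale T f"
    and I: "finite I" and k: "k \<in> I" "a k \<in> span (a ` (I - {k}))"
    and u: "u - (\<Sum>i\<in>I. f (a i, b i)) \<in> T"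
  shows "\<exists>b'. u - (\<Sum>i\<in>I - {k}. f (a i, b' i)) \<in> T"
proof -
  let ?J = "I - {k}"
  obtain c where c: "f (a k, b k) - (\<Sum>j\<in>?J. f (a j, c j)) \<in> T"
    using bilinear_mod_expand_left[OF T f _ k(2)] I by blast
  have "(\<Sum>j\<in>?J. f (a j, b j + c j) - f (a j, b j) - f (a j, c j)) \<in> T"
    using f unfolding bilinear_mod_def by (intro free.subspace_sum[OF T]) blast
  from free.subspace_diff[OF T free.subspace_add[OF T u c] this]
  have "u - (\<Sum>j\<in>?J. f (a j, b j + c j)) \<in> T"
    by (simp add: sum.remove[OF I k(1)] sum_subtractf sum.distrib algebra_simps)
  then show ?thesis
    by (rule exI[of _ "\<lambda>j. b j + c j"])
qed

text \<open>Take a representation with the fewest summands.\<close>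

lemma tensor_independent_rep:
  fixes u :: "'b \<times> 'b \<Rightarrow>\<^sub>0 'a"
  obtains I :: "('b \<times> 'b) set" and a b where "finite I"
    and "u - (\<Sum>i\<in>I. gen (a i, b i)) \<in> tensor_null scale"
    and "\<And>k. k \<in> I \<Longrightarrow> a k \<notin> span (a ` (I - {k}))"
    and "\<And>k. k \<in> I \<Longrightarrow> b k \<notin> span (b ` (I - {k}))"
proof -
  define Q where "Q = (\<lambda>I :: ('b \<times> 'b) set. finite I \<and>
    (\<exists>a b. u - (\<Sum>i\<in>I. gen (a i, b i)) \<in> tensor_null scale))"
  \<comment> \<open>The first representation is indexed by the support of \<open>u\<close>, with the
    coefficients moved into the left factors; hence index sets of pairs.\<close>
  let ?c = "\<lambda>p. scale (Poly_Mapping.lookup u p) (fst p)"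
  have "fscale (Poly_Mapping.lookup u p) (gen p) - gen (?c p, snd p) \<in> tensor_null scale" for p
    using bilinear_mod_gen[of scale] free.subspace_neg[OF subspace_tensor_null]
    unfolding bilinear_mod_def by (metis minus_diff_eq prod.collapse)
  then have "(\<Sum>p\<in>Poly_Mapping.keys u.
      fscale (Poly_Mapping.lookup u p) (gen p) - gen (?c p, snd p)) \<in> tensor_null scale"
    by (intro free.subspace_sum[OF subspace_tensor_null])
  then have "u - (\<Sum>p\<in>Poly_Mapping.keys u. gen (?c p, snd p)) \<in> tensor_null scale"
    unfolding sum_subtractf lsum_def[symmetric] lsum_gen_id .
  then have "Q (Poly_Mapping.keys u)"
    unfolding Q_def by (intro conjI finite_keys exI[of _ ?c] exI[of _ snd])
  from ex_has_least_nat[of Q, OF this, of card]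
  obtain I where I: "Q I" and least: "\<And>J. Q J \<Longrightarrow> card I \<le> card J"
    by blast
  then obtain a b where fin: "finite I"
    and rep: "u - (\<Sum>i\<in>I. gen (a i, b i)) \<in> tensor_null scale"
    unfolding Q_def by blast
  have shorter: "\<not> Q (I - {k})" if "k \<in> I" for k
    using least[of "I - {k}"] card_Diff1_less[OF fin that] by auto
  have "a k \<notin> span (a ` (I - {k}))" if k: "k \<in> I" for k
  proof
    assume "a k \<in> span (a ` (I - {k}))"
    from bilinear_mod_shorten[OF subspace_tensor_null bilinear_mod_gen fin k this rep]
    show False
      using shorter[OF k] fin unfolding Q_def by blast
  qed
  moreover have "b k \<notin> span (b ` (I - {k}))" if k: "k \<in> I" for k
  proof
    assume "b k \<in> span (b ` (I - {k}))"
    \<comment> \<open>After the swap, \<open>b\<close> plays the role of the left family.\<close>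
    from bilinear_mod_shorten[OF subspace_tensor_null bilinear_mod_swap[OF bilinear_mod_gen]
        fin k this, of u a] rep
    show False
      using shorter[OF k] fin unfolding Q_def by auto
  qed
  ultimately show ?thesis
    using that fin rep by blast
qed

text \<open>A basis of the span of \<open>S\<close> stays independent when \<open>x\<close> is
  added. Prescribe 1 at \<open>x\<close> and 0 on the basis, and extend linearly.\<close>

lemma separating_functional:
  assumes "x \<notin> span S"
  obtains \<alpha> where "Vector_Spaces.linear scale (*) \<alpha>" "\<alpha> x = 1" "\<And>y. y \<in> S \<Longrightarrow> \<alpha> y = 0"
proof -
  interpret K: vector_space "(*) :: 'a \<Rightarrow> 'a \<Rightarrow> 'a"
    by unfold_locales (auto simp: algebra_simps)
  interpret pair: vector_space_pair scale "(*) :: 'a \<Rightarrow> 'a \<Rightarrow> 'a" ..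
  obtain B where B: "B \<subseteq> S" "independent B" "S \<subseteq> span B"
    using maximal_independent_subset by blast
  have x: "x \<notin> span B"
    using assms span_mono[OF B(1)] by blast
  then have "independent (insert x B)"
    using B(2) by (simp add: independent_insertI)
  then obtain \<alpha> where \<alpha>: "Vector_Spaces.linear scale (*) \<alpha>"
    "\<forall>y\<in>insert x B. \<alpha> y = (if y = x then 1 else 0)"
    using pair.linear_independent_extend[of "insert x B" "\<lambda>y. if y = x then 1 else 0"] by blast
  interpret \<alpha>: Vector_Spaces.linear scale "(*)" \<alpha>
    by (rule \<alpha>(1))
  have "\<alpha> y = 0" if "y \<in> B" for y
    using \<alpha>(2) x that span_base by fastforce
  then have "\<alpha> y = 0" if "y \<in> S" for y
    using \<alpha>.eq_0_on_span B(3) that by blast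
  with \<alpha> that show ?thesis
    by simp
qed

text \<open>Bilinearity in the last two and in the first two arguments together covers all six
  families of relations.\<close>

lemma lsum_tensor3_null:
  assumes T: "free.subspace T"
    and "\<And>x. bilinear_mod scale T (\<lambda>(y, z). f (x, y, z))"
    and "\<And>z. bilinear_mod scale T (\<lambda>(x, y). f (x, y, z))"
    and u: "u \<in> tensor3_null scale"
  shows "lsum f u \<in> T"
  using assms(2,3) by (intro lsum_span[OF T _ u[unfolded tensor3_null_def]])
    (auto simp: bilinear_mod_def lsum.diff lsum.scale)

text \<open>This makes \<alpha> \<otimes> id \<otimes> id and id \<otimes> id \<otimes> \<alpha>
  well defined as maps from triple to double tensors.\<close>

lemma slice_tensor3_null:
  assumes "Vector_Spaces.linear scale (*) \<alpha>" and u: "u \<in> tensor3_null scale"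
  shows "lsum (\<lambda>(x, y, z). fscale (\<alpha> x) (gen (y, z))) u \<in> tensor_null scale" (is ?left)
    and "lsum (\<lambda>(x, y, z). fscale (\<alpha> z) (gen (x, y))) u \<in> tensor_null scale" (is ?right)
proof -
  interpret \<alpha>: Vector_Spaces.linear scale "(*)" \<alpha>
    by fact
  let ?N = "tensor_null scale"
  have gen: "bilinear_mod scale ?N (gen :: _ \<Rightarrow> 'b \<times> 'b \<Rightarrow>\<^sub>0 'a)"
    by (rule bilinear_mod_gen)
  have zero: "0 \<in> ?N"
    by (rule free.subspace_0[OF subspace_tensor_null])
  have scale: "fscale c w \<in> ?N" if "w \<in> ?N" for c w
    using free.subspace_scale[OF subspace_tensor_null that] .
  have \<alpha>_add: "fscale (\<alpha> x + \<alpha> x') w - fscale (\<alpha> x) w - fscale (\<alpha> x') w = 0"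
    for x x' and w :: "'b \<times> 'b \<Rightarrow>\<^sub>0 'a"
    by (simp add: free.scale_left_distrib)
  have "bilinear_mod scale ?N (\<lambda>(y, z). fscale c (gen (y, z)))" for c
    using bilinear_mod_fscale[OF subspace_tensor_null gen, of c] by (simp add: split_def)
  moreover have "bilinear_mod scale ?N (\<lambda>(x, y). fscale (\<alpha> x) (gen (y, z)))"
    "bilinear_mod scale ?N (\<lambda>(x, y). fscale (\<alpha> y) (gen (z, x)))" for z
    using gen unfolding bilinear_mod_def
    by (simp_all only: prod.case \<alpha>.add \<alpha>.scale \<alpha>_add zero free.scale_scale[symmetric]
        free.scale_left_commute[of _ "\<alpha> _"] free.scale_right_diff_distrib[symmetric] scale
        diff_self free.scale_zero_right simp_thms)
  ultimately show ?left ?right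
    using u by (auto intro!: lsum_tensor3_null[OF subspace_tensor_null])
qed

end


section \<open>The wedge product of subcoalgebras\<close>

lemma tensor3_null_gen:
  "gen (x + x', y, z) - gen (x, y, z) - gen (x', y, z) \<in> tensor3_null scl"
  "gen (x, y + y', z) - gen (x, y, z) - gen (x, y', z) \<in> tensor3_null scl"
  "gen (x, y, z + z') - gen (x, y, z) - gen (x, y, z') \<in> tensor3_null scl"
  "gen (scl a x, y, z) - fscale a (gen (x, y, z)) \<in> tensor3_null scl"
  "gen (x, scl a y, z) - fscale a (gen (x, y, z)) \<in> tensor3_null scl"
  "gen (x, y, scl a z) - fscale a (gen (x, y, z)) \<in> tensor3_null scl"
  unfolding tensor3_null_def
  by (rule free.span_base, simp only: Un_iff mem_Collect_eq, metis)+

lemma bilinear_mod_tensor3: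
  "bilinear_mod scl (tensor3_null scl) (\<lambda>(x, y). gen (x, y, z))"
  "bilinear_mod scl (tensor3_null scl) (\<lambda>(x, y). gen (z, x, y))"
  by (simp_all add: bilinear_mod_def tensor3_null_gen)

section \<open>Comultiplication on representatives\<close>

context coalgebra
begin

text \<open>An arbitrary choice, hence additive and homogeneous only modulo
  \<open>tensor_null\<close>.\<close>

abbreviation comult_rep :: "'c \<Rightarrow> ('c \<times> 'c \<Rightarrow>\<^sub>0 'k)"
  where "comult_rep x \<equiv> qrep (\<Delta> x)"

lemma qclass_comult_rep: "qclass (tensor_null scl) (comult_rep x) = \<Delta> x"
  using qclass_qrep[OF subspace_tensor_null[of scl]] comult_in by (simp add: tensor_space_def)

lemma comult_rep_add:
  "comult_rep (x + y) - comult_rep x - comult_rep y \<in> tensor_null scl"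
proof -
  have "qclass (tensor_null scl) (comult_rep (x + y)) =
    qclass (tensor_null scl) (comult_rep x + comult_rep y)"
    unfolding qadd_qclass[OF subspace_tensor_null, symmetric] qclass_comult_rep
    by (rule comult_add)
  then show ?thesis
    by (simp add: qclass_eq_iff[OF subspace_tensor_null] diff_diff_eq)
qed

lemma comult_rep_scale:
  "comult_rep (scl a x) - fscale a (comult_rep x) \<in> tensor_null scl"
proof -
  have "qclass (tensor_null scl) (comult_rep (scl a x)) =
    qclass (tensor_null scl) (fscale a (comult_rep x))"
    unfolding qscale_qclass[OF subspace_tensor_null, symmetric] qclass_comult_rep
    by (rule comult_scale)
  then show ?thesis
    by (simp add: qclass_eq_iff[OF subspace_tensor_null])
qed

lemma comult_in_tensor_sub_iff: "\<Delta> x \<in> tensor_sub scl X Y \<longleftrightarrow> comult_rep x \<in> tspan scl (X \<times> Y)"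
  using qclass_in_tensor_sub_iff[of scl "comult_rep x" X Y] by (simp add: qclass_comult_rep)

text \<open>The sum of two subspaces is the span of the union of their generators, and
  \<open>tspan\<close> contains all relations, so the choice of representative is
  immaterial.\<close>

lemma wedge_iff: "x \<in> wedge X Y \<longleftrightarrow> comult_rep x \<in> tspan scl (X \<times> UNIV \<union> UNIV \<times> Y)"
proof -
  let ?N = "tensor_null scl"
  have tspan_Un: "tspan scl (A \<union> B) = {u + v | u v. u \<in> tspan scl A \<and> v \<in> tspan scl B}" for A B
  proof -
    have "gen ` (A \<union> B) \<union> ?N = (gen ` A \<union> ?N) \<union> (gen ` B \<union> ?N)"
      by blast
    then show ?thesis
      unfolding tspan_def by (simp only: free.span_Un)
  qed
  have mem: "s \<in> tensor_sub scl A B \<longleftrightarrow> (\<exists>u\<in>tspan scl (A \<times> B). s = qclass ?N u)" for s A B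
    using qclass_in_tensor_sub_iff[of scl _ A B] unfolding tensor_sub_def by blast
  have "x \<in> wedge X Y \<longleftrightarrow> (\<exists>u v. \<Delta> x = qclass ?N (u + v) \<and>
      u \<in> tspan scl (X \<times> UNIV) \<and> v \<in> tspan scl (UNIV \<times> Y))"
    unfolding wedge_def vimage_def mem using qadd_qclass[OF subspace_tensor_null, of scl]
    by (simp, metis)
  also have "\<dots> \<longleftrightarrow> (\<exists>u\<in>tspan scl (X \<times> UNIV \<union> UNIV \<times> Y). \<Delta> x = qclass ?N u)"
    unfolding tspan_Un by blast
  also have "\<dots> \<longleftrightarrow> comult_rep x \<in> tspan scl (X \<times> UNIV \<union> UNIV \<times> Y)"
    using tspan_cong qclass_comult_rep qclass_eq_iff[OF subspace_tensor_null] by metis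
  finally show ?thesis .
qed

lemma subspace_wedge: "subspace (wedge X Y)"
proof (rule subspaceI)
  let ?T = "tspan scl (X \<times> UNIV \<union> UNIV \<times> Y)"
  note T = subspace_tspan[of scl "X \<times> UNIV \<union> UNIV \<times> Y"]
  show add: "x + y \<in> wedge X Y" if "x \<in> wedge X Y" "y \<in> wedge X Y" for x y
    using free.subspace_add[OF T] that tspan_cong[OF comult_rep_add[unfolded diff_diff_eq]]
    unfolding wedge_iff by blast
  show scale: "scl c x \<in> wedge X Y" if "x \<in> wedge X Y" for c x
    using free.subspace_scale[OF T] that tspan_cong[OF comult_rep_scale]
    unfolding wedge_iff by blast
  \<comment> \<open>\<open>comult_rep 0\<close> may be a nonzero relation, so zero is reached
    through homogeneity with scalar 0.\<close>
  have "fscale 0 (comult_rep 0) \<in> ?T"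
    using free.subspace_0[OF T] by simp
  then show "0 \<in> wedge X Y"
    using tspan_cong[OF comult_rep_scale[of 0 0]] unfolding wedge_iff by simp
qed

definition comult_left_rep :: "'c \<times> 'c \<Rightarrow> ('c \<times> 'c \<times> 'c \<Rightarrow>\<^sub>0 'k)"
  where "comult_left_rep = (\<lambda>(x, y). lsum (\<lambda>(x\<^sub>1, x\<^sub>2). gen (x\<^sub>1, x\<^sub>2, y)) (comult_rep x))"

definition comult_right_rep :: "'c \<times> 'c \<Rightarrow> ('c \<times> 'c \<times> 'c \<Rightarrow>\<^sub>0 'k)"
  where "comult_right_rep = (\<lambda>(x, y). lsum (\<lambda>(y\<^sub>1, y\<^sub>2). gen (x, y\<^sub>1, y\<^sub>2)) (comult_rep y))"

text \<open>In \<open>x\<close> this combines linearity of \<Delta> modulo relations with the fact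
  that \<open>g y\<close> sends relations into \<open>N\<close>; in \<open>y\<close> it holds
  summand by summand. It serves both lifts of \<Delta> to triple tensors and the slices.\<close>

lemma bilinear_mod_lsum_comult:
  assumes N: "free.subspace N" and g: "\<And>y. bilinear_mod scl N (g y)"
    and add: "\<And>y y' p. g (y + y') p - g y p - g y' p \<in> N"
    and scale: "\<And>a y p. g (scl a y) p - fscale a (g y p) \<in> N"
  shows "bilinear_mod scl N (\<lambda>(x, y). lsum (g y) (comult_rep x))"
proof -
  have null: "lsum (g y) u \<in> N" if "u \<in> tensor_null scl" for y u
    using lsum_tensor_null[OF N g that] .
  show ?thesis
    unfolding bilinear_mod_def prod.case
  proof (intro conjI allI)
    fix x x' y y' a
    show "lsum (g y) (comult_rep (x + x')) - lsum (g y) (comult_rep x) -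
        lsum (g y) (comult_rep x') \<in> N"
      using null[OF comult_rep_add] by (simp only: lsum.diff)
    show "lsum (g y) (comult_rep (scl a x)) - fscale a (lsum (g y) (comult_rep x)) \<in> N"
      using null[OF comult_rep_scale] by (simp only: lsum.diff lsum.scale)
    show "lsum (g (y + y')) (comult_rep x) - lsum (g y) (comult_rep x) -
        lsum (g y') (comult_rep x) \<in> N"
      unfolding lsum_fun_diff[symmetric] by (rule lsum_in_subspace[OF N add])
    show "lsum (g (scl a y)) (comult_rep x) - fscale a (lsum (g y) (comult_rep x)) \<in> N"
      unfolding lsum_fun_diff[symmetric] lsum_fun_scale[symmetric]
      by (rule lsum_in_subspace[OF N scale])
  qed
qed

lemma bilinear_mod_comult_rep:
  "bilinear_mod scl (tensor3_null scl) comult_left_rep"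
  "bilinear_mod scl (tensor3_null scl) comult_right_rep"
proof -
  show "bilinear_mod scl (tensor3_null scl) comult_left_rep"
    unfolding comult_left_rep_def
    by (intro bilinear_mod_lsum_comult subspace_tensor3_null bilinear_mod_tensor3)
      (simp_all only: split_def tensor3_null_gen)
  \<comment> \<open>The argument that is comultiplied must come first here, so the order is swapped
    afterwards.\<close>
  have "bilinear_mod scl (tensor3_null scl)
      (\<lambda>(y, x). lsum (\<lambda>(y\<^sub>1, y\<^sub>2). gen (x, y\<^sub>1, y\<^sub>2)) (comult_rep y))"
    by (intro bilinear_mod_lsum_comult subspace_tensor3_null bilinear_mod_tensor3)
      (simp_all only: split_def tensor3_null_gen)
  from bilinear_mod_swap[OF this] show "bilinear_mod scl (tensor3_null scl) comult_right_rep"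
    by (simp add: comult_right_rep_def)
qed

lemma coassoc_rep:
  "lsum comult_left_rep (comult_rep x) - lsum comult_right_rep (comult_rep x) \<in> tensor3_null scl"
proof -
  let ?N = "tensor3_null scl"
  note N = subspace_tensor3_null[of scl]
  \<comment> \<open>The nested extensions are evaluated from the inside out.\<close>
  have "qlin_ext ?N (\<lambda>(x\<^sub>1, x\<^sub>2). tensor3 scl x\<^sub>1 x\<^sub>2 (snd p)) (\<Delta> (fst p)) = qclass ?N (comult_left_rep p)"
    for p
    using qlin_ext_tensor[OF N _ bilinear_mod_tensor3(1), of _ "snd p" "comult_rep (fst p)"]
    by (simp add: tensor3_def split_def comult_left_rep_def qclass_comult_rep)
  then have left: "comult_left scl \<Delta> (\<Delta> x) = qclass ?N (lsum comult_left_rep (comult_rep x))"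
    unfolding comult_left_def
    using qlin_ext_tensor[OF N _ bilinear_mod_comult_rep(1), of _ "comult_rep x"]
    by (simp add: split_def qclass_comult_rep)
  have "qlin_ext ?N (\<lambda>(y\<^sub>1, y\<^sub>2). tensor3 scl (fst p) y\<^sub>1 y\<^sub>2) (\<Delta> (snd p)) = qclass ?N (comult_right_rep p)"
    for p
    using qlin_ext_tensor[OF N _ bilinear_mod_tensor3(2), of _ "fst p" "comult_rep (snd p)"]
    by (simp add: tensor3_def split_def comult_right_rep_def qclass_comult_rep)
  then have right: "comult_right scl \<Delta> (\<Delta> x) = qclass ?N (lsum comult_right_rep (comult_rep x))"
    unfolding comult_right_def
    using qlin_ext_tensor[OF N _ bilinear_mod_comult_rep(2), of _ "comult_rep x"]
    by (simp add: split_def qclass_comult_rep)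
  show ?thesis
    unfolding qclass_eq_iff[OF N, symmetric] left[symmetric] right[symmetric] by (rule coassoc)
qed

text \<open>The two sums represent (\<alpha> \<otimes> \<Delta>)\<Delta>x and, up to order of
  factors, (\<Delta> \<otimes> \<alpha>)\<Delta>x. Coassociativity moves the second \<Delta> to the
  factor that \<alpha> hits, where the subcoalgebra property controls the result.\<close>

lemma slice_wedge:
  assumes \<alpha>: "Vector_Spaces.linear scl (*) \<alpha>"
    and X: "subcoalgebra X" and Y: "subcoalgebra Y" and x: "x \<in> wedge X Y"
  defines "T \<equiv> tspan scl (X \<times> UNIV \<union> UNIV \<times> Y)"
  shows "lsum (\<lambda>(y, z). fscale (\<alpha> y) (comult_rep z)) (comult_rep x) \<in> T" (is ?left)
    and "lsum (\<lambda>(y, z). fscale (\<alpha> z) (comult_rep y)) (comult_rep x) \<in> T" (is ?right)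
proof -
  let ?L = "lsum (\<lambda>(x, y, z). fscale (\<alpha> x) (gen (y, z))) :: _ \<Rightarrow> ('c \<times> 'c \<Rightarrow>\<^sub>0 'k)"
  let ?R = "lsum (\<lambda>(x, y, z). fscale (\<alpha> z) (gen (x, y))) :: _ \<Rightarrow> ('c \<times> 'c \<Rightarrow>\<^sub>0 'k)"
  have T: "free.subspace T" and NT: "tensor_null scl \<subseteq> T"
    by (simp_all add: T_def subspace_tspan tensor_null_le_tspan)
  have slice: "?L u \<in> T" "?R u \<in> T" if "u \<in> tensor3_null scl" for u
    using slice_tensor3_null[OF \<alpha> that] NT by blast+
  have gen: "gen (y, z) \<in> T" if "y \<in> X \<or> z \<in> Y" for y z
    unfolding T_def using that by (auto intro: gen_in_tspan)
  have X_rep: "comult_rep y \<in> tspan scl (X \<times> X)" if "y \<in> X" for y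
    using X that by (auto simp: subcoalgebra_def comult_in_tensor_sub_iff)
  have Y_rep: "comult_rep y \<in> tspan scl (Y \<times> Y)" if "y \<in> Y" for y
    using Y that by (auto simp: subcoalgebra_def comult_in_tensor_sub_iff)
  have xT: "comult_rep x \<in> tspan scl (X \<times> UNIV \<union> UNIV \<times> Y)"
    using x by (simp add: wedge_iff)
  have embed:
    "bilinear_mod scl T (\<lambda>p. ?L ((\<lambda>(x, y). gen (x, y, z)) p))"
    "bilinear_mod scl T (\<lambda>p. ?R ((\<lambda>(x, y). gen (z, x, y)) p))" for z
    by (rule bilinear_mod_lsum[OF _ slice(1)] bilinear_mod_lsum[OF _ slice(2)],
        rule bilinear_mod_tensor3, assumption)+
  have "?L (comult_left_rep (y, z)) \<in> T" if "y \<in> X \<or> z \<in> Y" for y z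
    using that
  proof
    \<comment> \<open>Both legs of \<Delta>y lie in \<open>X\<close>; \<alpha> consumes the first,
      and the second remains as a left factor in \<open>X\<close>.\<close>
    assume "y \<in> X"
    then show ?thesis
      unfolding comult_left_rep_def prod.case lsum_lsum
      by (intro lsum_tspan[OF T embed(1) _ X_rep]) (auto intro!: free.subspace_scale[OF T] gen)
  next
    \<comment> \<open>The right factor \<open>z\<close> survives in every term, whatever \<Delta>y
      is.\<close>
    assume "z \<in> Y"
    then show ?thesis
      unfolding comult_left_rep_def prod.case lsum_lsum
      by - (rule lsum_in_subspace[OF T], auto intro!: free.subspace_scale[OF T] gen)
  qed
  then have "lsum (\<lambda>p. ?L (comult_left_rep p)) (comult_rep x) \<in> T"
    by (intro lsum_tspan[OF T bilinear_mod_lsum[OF bilinear_mod_comult_rep(1) slice(1)] _ xT])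
      auto
  \<comment> \<open>Coassociativity replaces \<Delta> \<otimes> id by id \<otimes> \<Delta> up to a
    triple relation, whose slice lies in \<open>T\<close>.\<close>
  from free.subspace_diff[OF T this slice(1)[OF coassoc_rep[of x]]]
  have "?L (lsum comult_right_rep (comult_rep x)) \<in> T"
    by (simp add: lsum_lsum lsum.diff)
  moreover have "(\<lambda>p. ?L (comult_right_rep p)) = (\<lambda>(y, z). fscale (\<alpha> y) (comult_rep z))"
    unfolding comult_right_rep_def by (simp add: lsum_lsum split_def lsum_fun_scale)
  ultimately show ?left
    by (simp only: lsum_lsum)
  \<comment> \<open>Mirror image: now the last leg is consumed, and for \<open>z \<in> Y\<close> the
    middle leg stays in \<open>Y\<close>.\<close>
  have "?R (comult_right_rep (y, z)) \<in> T" if "y \<in> X \<or> z \<in> Y" for y z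
    using that
  proof
    assume "z \<in> Y"
    then show ?thesis
      unfolding comult_right_rep_def prod.case lsum_lsum
      by (intro lsum_tspan[OF T embed(2) _ Y_rep]) (auto intro!: free.subspace_scale[OF T] gen)
  next
    assume "y \<in> X"
    then show ?thesis
      unfolding comult_right_rep_def prod.case lsum_lsum
      by - (rule lsum_in_subspace[OF T], auto intro!: free.subspace_scale[OF T] gen)
  qed
  then have "lsum (\<lambda>p. ?R (comult_right_rep p)) (comult_rep x) \<in> T"
    by (intro lsum_tspan[OF T bilinear_mod_lsum[OF bilinear_mod_comult_rep(2) slice(2)] _ xT])
      auto
  from free.subspace_add[OF T this slice(2)[OF coassoc_rep[of x]]]
  have "?R (lsum comult_left_rep (comult_rep x)) \<in> T"
    by (simp add: lsum_lsum lsum.diff)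
  moreover have "(\<lambda>p. ?R (comult_left_rep p)) = (\<lambda>(y, z). fscale (\<alpha> z) (comult_rep y))"
    unfolding comult_left_rep_def by (simp add: lsum_lsum split_def lsum_fun_scale)
  ultimately show ?right
    by (simp only: lsum_lsum)
qed

text \<open>Well-definedness of \<alpha> \<otimes> \<Delta>, by which the slices of \<Delta>x can be
  computed from a minimal representation.\<close>

lemma bilinear_mod_slice:
  assumes "Vector_Spaces.linear scl (*) \<alpha>"
  shows "bilinear_mod scl (tensor_null scl) (\<lambda>(y, z). fscale (\<alpha> y) (comult_rep z))"
proof -
  interpret \<alpha>: Vector_Spaces.linear scl "(*)" \<alpha>
    by fact
  note N = subspace_tensor_null[of scl]
  have "bilinear_mod scl (tensor_null scl)
      (\<lambda>(z, y). lsum (\<lambda>p. fscale (\<alpha> y) (gen p)) (comult_rep z))"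
    by (intro bilinear_mod_lsum_comult N bilinear_mod_fscale bilinear_mod_gen)
      (simp_all add: \<alpha>.add \<alpha>.scale free.scale_left_distrib free.subspace_0[OF N])
  from bilinear_mod_swap[OF this] show ?thesis
    by (simp add: lsum_fun_scale)
qed

lemma subcoalgebra_wedge:
  assumes X: "subcoalgebra X" and Y: "subcoalgebra Y"
  shows "subcoalgebra (wedge X Y)"
  unfolding subcoalgebra_def
proof (intro conjI subspace_wedge image_subsetI)
  fix x assume x: "x \<in> wedge X Y"
  let ?W = "wedge X Y" and ?T = "tspan scl (X \<times> UNIV \<union> UNIV \<times> Y)"
  have T: "free.subspace ?T"
    by (rule subspace_tspan)
  obtain I :: "('c \<times> 'c) set" and a b where I: "finite I"
    and rep: "comult_rep x - (\<Sum>i\<in>I. gen (a i, b i)) \<in> tensor_null scl" (is "_ - ?u \<in> _")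
    and a: "\<And>k. k \<in> I \<Longrightarrow> a k \<notin> span (a ` (I - {k}))"
    and b: "\<And>k. k \<in> I \<Longrightarrow> b k \<notin> span (b ` (I - {k}))"
    using tensor_independent_rep[of "comult_rep x"] by blast
  \<comment> \<open>Replaces the chosen representative of \<Delta>x by the minimal sum, at the cost
    of an element of \<open>?T\<close>.\<close>
  have transfer: "(\<Sum>i\<in>I. f (a i, b i)) \<in> ?T"
    if "lsum f (comult_rep x) \<in> ?T" "bilinear_mod scl (tensor_null scl) f" for f
  proof -
    have "lsum f (comult_rep x - ?u) \<in> ?T"
      using lsum_tensor_null[OF T bilinear_mod_mono[OF that(2) tensor_null_le_tspan] rep] .
    from free.subspace_diff[OF T that(1) this] show ?thesis
      by (simp add: lsum.diff lsum.sum)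
  qed
  have "a k \<in> ?W" "b k \<in> ?W" if k: "k \<in> I" for k
  proof -
    obtain \<beta> where \<beta>: "Vector_Spaces.linear scl (*) \<beta>"
      "\<beta> (b k) = 1" "\<And>y. y \<in> b ` (I - {k}) \<Longrightarrow> \<beta> y = 0"
      using separating_functional[OF b[OF k]] by blast
    \<comment> \<open>As \<beta> is dual to \<open>b k\<close>, only the summand
      \<open>comult_rep (a k)\<close> is left.\<close>
    have "(\<Sum>i\<in>I. fscale (\<beta> (b i)) (comult_rep (a i))) \<in> ?T"
      using transfer[OF slice_wedge(2)[OF \<beta>(1) X Y x]]
        bilinear_mod_swap[OF bilinear_mod_slice[OF \<beta>(1)]] by (simp add: split_def)
    then show "a k \<in> ?W"
      using I k \<beta> by (simp add: wedge_iff sum.remove[of I k])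
    obtain \<alpha> where \<alpha>: "Vector_Spaces.linear scl (*) \<alpha>"
      "\<alpha> (a k) = 1" "\<And>y. y \<in> a ` (I - {k}) \<Longrightarrow> \<alpha> y = 0"
      using separating_functional[OF a[OF k]] by blast
    have "(\<Sum>i\<in>I. fscale (\<alpha> (a i)) (comult_rep (b i))) \<in> ?T"
      using transfer[OF slice_wedge(1)[OF \<alpha>(1) X Y x]] bilinear_mod_slice[OF \<alpha>(1)]
      by (simp add: split_def)
    then show "b k \<in> ?W"
      using I k \<alpha> by (simp add: wedge_iff sum.remove[of I k])
  qed
  then have "?u \<in> tspan scl (?W \<times> ?W)"
    by (intro free.subspace_sum[OF subspace_tspan] gen_in_tspan) auto
  then show "\<Delta> x \<in> tensor_sub scl ?W ?W"
    unfolding comult_in_tensor_sub_iff tspan_cong[OF rep] .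
qed

end

section \<open>Invariance of the wedge product under the operator\<close>

theorem proposition2p5:
  fixes scl :: "'k::field_char_0 \<Rightarrow> 'c::ab_group_add \<Rightarrow> 'c"
    and \<Delta> :: "'c \<Rightarrow> ('c \<times> 'c \<Rightarrow>\<^sub>0 'k) set"
    and \<epsilon> :: "'c \<Rightarrow> 'k"
    and P :: "'c \<Rightarrow> 'c"
    and weight :: 'k
    and X Y :: "'c set"
  assumes "rota_baxter_coalgebra scl \<Delta> \<epsilon> P weight"
    and "\<And>x. \<Delta> (P x) = tensor_map scl P P (\<Delta> x)"
    and "rota_baxter_coalgebra.rota_baxter_subcoalgebra scl \<Delta> P X"
    and "rota_baxter_coalgebra.rota_baxter_subcoalgebra scl \<Delta> P Y"
  shows "rota_baxter_coalgebra.rota_baxter_subcoalgebra scl \<Delta> P (coalgebra.wedge scl \<Delta> X Y)"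
proof -
  interpret rota_baxter_coalgebra scl \<Delta> \<epsilon> P weight
    by fact
  interpret P: Vector_Spaces.linear scl scl P
    by (rule operator_linear)
  have X: "subcoalgebra X" "P ` X \<subseteq> X" and Y: "subcoalgebra Y" "P ` Y \<subseteq> Y"
    using assms(3,4) by (simp_all add: rota_baxter_subcoalgebra_def)
  let ?T = "tspan scl (X \<times> UNIV \<union> UNIV \<times> Y)" and ?f = "\<lambda>(x, y). gen (P x, P y)"
  have f: "bilinear_mod scl (tensor_null scl) ?f"
    using bilinear_mod_gen[of scl] by (simp add: bilinear_mod_def P.add P.scale)
  have "P x \<in> wedge X Y" if "x \<in> wedge X Y" for x
  proof -
    \<comment> \<open>\<open>?f\<close> lifts P \<otimes> P, which keeps left factors in
      \<open>X\<close> and right factors in \<open>Y\<close>.\<close>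
    have "lsum ?f (comult_rep x) \<in> ?T"
      using that X(2) Y(2) unfolding wedge_iff
      by (intro lsum_tspan[OF subspace_tspan bilinear_mod_mono[OF f tensor_null_le_tspan]])
        (auto intro!: gen_in_tspan)
    moreover have "\<Delta> (P x) = qclass (tensor_null scl) (lsum ?f (comult_rep x))"
      using qlin_ext_tensor[OF subspace_tensor_null _ f, of _ "comult_rep x"]
      by (simp add: assms(2) tensor_map_def tensor_def split_def qclass_comult_rep)
    then have "comult_rep (P x) - lsum ?f (comult_rep x) \<in> tensor_null scl"
      using qrep_qclass[OF subspace_tensor_null] by simp
    ultimately show ?thesis
      unfolding wedge_iff by (simp only: tspan_cong)
  qed
  then show ?thesis
    using subcoalgebra_wedge[OF X(1) Y(1)] by (auto simp: rota_baxter_subcoalgebra_def)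
qed

end
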